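(* Let $k$ be a field and $R=k[[x,y]]$ with maximal ideal $\mathfrak m=(x,y)$. For each integer $N\ge2$, set $$J_N:=\overline{(x^N,\,y^{N^2})}\subseteq R.$$ Let $\mathcal V$ be any finite set of real-valued rank-one valuations on $R$ centered at $\mathfrak m$. Then there exist integers $N\ge2$ and $p,q\ge1$ such that: (1) for every $v\in\mathcal V$, one has $v(\mathfrak m^q)\ge v(J_N^p)$; (2) nevertheless, $\mathfrak m^q\not\subseteq J_N^p=\overline{J_N^p}$. In particular, no single finite set of valuations can serve as a universal testing set for all containments of the form $\mathfrak m^q\subseteq\overline{J_N^p}$ as $N$ varies.
   Context: $\overline I$ denotes the integral closure of an ideal $I$. A real-valued rank-one valuation on $R$ centered at $\mathfrak m$ is a map $v:R\setminus\{0\}\to\mathbb R_{\ge0}$ with $v(fg)=v(f)+v(g)$, $v(f+g)\ge\min\{v(f),v(g)\}$, and $v(f)>0$ for all $f\in\mathfrak m$, extended by $v(0)=\infty$. For an ideal $I$, $v(I)=\min\{v(f):f\in I\}$. *)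

theory Defs
  imports
    "HOL-Computational_Algebra.Formal_Power_Series"
    "HOL-Library.Extended_Real"
begin

text \<open>
  An ideal of a commutative ring is a submodule of the ring over itself, so
  \<open>ideal.subspace I\<close> says that \<open>I\<close> is an ideal and \<open>ideal.span S\<close> is the ideal generated by \<open>S\<close>.
\<close>

interpretation ideal: module "(*) :: 'a::comm_ring_1 \<Rightarrow> 'a \<Rightarrow> 'a"
  by unfold_locales (simp_all add: algebra_simps)

definition ideal_prod :: "'a::comm_ring_1 set \<Rightarrow> 'a set \<Rightarrow> 'a set" where
  "ideal_prod I J = ideal.span {a * b | a b. a \<in> I \<and> b \<in> J}"

primrec ideal_power :: "'a::comm_ring_1 set \<Rightarrow> nat \<Rightarrow> 'a set" where
  "ideal_power I 0 = UNIV"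
| "ideal_power I (Suc n) = ideal_prod I (ideal_power I n)"

definition integral_closure :: "'a::comm_ring_1 set \<Rightarrow> 'a set" where
  "integral_closure I =
    {r. \<exists>n\<ge>1. \<exists>a. (\<forall>i\<in>{1..n}. a i \<in> ideal_power I i) \<and>
          r ^ n + (\<Sum>i=1..n. a i * r ^ (n - i)) = 0}"

text \<open>
  Requiring \<open>v f\<close> to be finite and strictly positive on the nonzero elements of \<open>\<mm>\<close> makes
  \<open>v\<close> of rank one as soon as \<open>\<mm>\<close> is not zero.
\<close>

definition centered_valuation :: "'a::idom set \<Rightarrow> ('a \<Rightarrow> ereal) \<Rightarrow> bool" where
  "centered_valuation \<mm> v \<longleftrightarrow>
     v 0 = \<infinity> \<and>
     (\<forall>f. f \<noteq> 0 \<longrightarrow> 0 \<le> v f \<and> v f < \<infinity>) \<and>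
     (\<forall>f g. v (f * g) = v f + v g) \<and>
     (\<forall>f g. v (f + g) \<ge> min (v f) (v g)) \<and>
     (\<forall>f\<in>\<mm>. v f > 0)"

text \<open>
  \<open>LEAST\<close> denotes the minimum when there is one; the lemma below shows that there is
  one for every finitely generated ideal, hence for every ideal of a Noetherian ring.
\<close>

definition val_ideal :: "('a \<Rightarrow> ereal) \<Rightarrow> 'a set \<Rightarrow> ereal" where
  "val_ideal v I = (LEAST t. t \<in> v ` I)"

lemma val_ideal_span_finite:
  assumes v: "centered_valuation \<mm> v" and S: "finite S" "S \<noteq> {}"
  shows "val_ideal v (ideal.span S) \<in> v ` ideal.span S"
    and "f \<in> ideal.span S \<Longrightarrow> val_ideal v (ideal.span S) \<le> v f"
proof -
  define t where "t = Min (v ` S)"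
  have t_in: "t \<in> v ` ideal.span S"
    using Min_in[of "v ` S"] S image_mono[OF ideal.span_superset[of S], of v]
    unfolding t_def by blast
  have nonneg: "0 \<le> v r" for r
    using v unfolding centered_valuation_def by (cases "r = 0") auto
  have t_le: "t \<le> v f" if "f \<in> ideal.span S" for f
    using that
  proof (induction rule: ideal.span_induct_alt)
    case base
    then show ?case using v by (simp add: centered_valuation_def)
  next
    case (step c x y)
    have "t \<le> v x" using step S by (simp add: t_def)
    also have "\<dots> \<le> v c + v x" using nonneg[of c] add_mono[of 0 "v c" "v x" "v x"] by simp
    also have "\<dots> = v (c * x)" using v by (simp add: centered_valuation_def)
    finally have "t \<le> min (v (c * x)) (v y)" using step by simp
    also have "\<dots> \<le> v (c * x + y)" using v unfolding centered_valuation_def by blast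
    finally show ?case .
  qed
  have eq: "val_ideal v (ideal.span S) = t"
    unfolding val_ideal_def by (rule Least_equality) (use t_in t_le in auto)
  show "val_ideal v (ideal.span S) \<in> v ` ideal.span S" using eq t_in by simp
  show "f \<in> ideal.span S \<Longrightarrow> val_ideal v (ideal.span S) \<le> v f" using eq t_le by simp
qed

text \<open>The ring \<open>k[[x,y]]\<close> is modelled as \<open>k[[x]][[y]]\<close>.\<close>

type_synonym 'k fps2 = "'k fps fps"

definition x_var :: "'k::field fps2" where "x_var = fps_const fps_X"

definition y_var :: "'k::field fps2" where "y_var = fps_X"

definition max_ideal :: "'k::field fps2 set" where
  "max_ideal = ideal.span {x_var, y_var}"

definition J :: "nat \<Rightarrow> 'k::field fps2 set" where
  "J N = integral_closure (ideal.span {x_var ^ N, y_var ^ (N ^ 2)})"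

text \<open>
  Only the nontrivial direction of the test is required: a containment
  \<open>\<mm>\<^sup>q \<subseteq> integral_closure (J\<^sub>N\<^sup>p)\<close> always implies the inequalities. Nonexistence of such a set
  is thus (formally) the stronger assertion.
\<close>

definition universal_testing_set :: "('k::field fps2 \<Rightarrow> ereal) set \<Rightarrow> bool" where
  "universal_testing_set V \<longleftrightarrow>
     (\<forall>N\<ge>2. \<forall>p\<ge>1. \<forall>q\<ge>1.
        (\<forall>v\<in>V. val_ideal v (ideal_power max_ideal q) \<ge> val_ideal v (ideal_power (J N) p)) \<longrightarrow>
        ideal_power max_ideal q \<subseteq> integral_closure (ideal_power (J N :: 'k fps2 set) p))"

end

(*
  Let w_N be the monomial valuation with w_N(x) = N and w_N(y) = 1. The ideal {w_N >= N^2} is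
  generated by the monomials x^i y^(N(N-i)), each of which is integral over (x^N, y^(N^2)), and it
  is integrally closed, so it is J_N. For a valuation v, as soon as N v(y) >= v(x), the minimum of v
  on J_N is N v(x). Hence if C >= 1 is an integer with v(x) <= C v(y) for all v in the finite set,
  then N = C + 1, p = 1, q = N C pass all the tests, whereas w_N(y^q) = q < N^2.
*)

theory Submission
  imports Defs
begin

unbundle fps_syntax

text \<open>As a simplification rule this is associativity from right to left and loops with \<open>mult_ac\<close>.\<close>

declare ideal.scale_scale [simp del]

section \<open>Ideals of the monomial weight with w(x) = N and w(y) = 1\<close>

text \<open>This is the valuation ideal {w_N >= m}. The outer variable is y, so
  \<open>f $ j $ i\<close> is the coefficient of x^i y^j, whose weight is
  \<open>N * i + j\<close>.\<close>

definition weight_ideal :: "nat \<Rightarrow> nat \<Rightarrow> 'k::field fps2 set" where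
  "weight_ideal N m = {f. \<forall>i j. N * i + j < m \<longrightarrow> f $ j $ i = 0}"

lemma weight_idealD: "f \<in> weight_ideal N m \<Longrightarrow> N * i + j < m \<Longrightarrow> f $ j $ i = 0"
  by (simp add: weight_ideal_def)

lemma weight_ideal_mono: "m \<le> m' \<Longrightarrow> weight_ideal N m' \<subseteq> weight_ideal N m"
  by (auto simp: weight_ideal_def)

lemma fps2_mult_nth:
  fixes f g :: "'k::field fps2"
  shows "(f * g) $ j $ i = (\<Sum>b=0..j. \<Sum>a=0..i. f $ b $ a * g $ (j - b) $ (i - a))"
  by (simp add: fps_mult_nth fps_sum_nth)

text \<open>If x^i y^j has weight below m + m', then in any factorization into two monomials one
  factor is too light to occur in its series.\<close>

lemma weight_ideal_mult:
  assumes f: "f \<in> weight_ideal N m" and g: "g \<in> weight_ideal N m'"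
  shows "f * g \<in> weight_ideal N (m + m')"
  unfolding weight_ideal_def
proof safe
  fix i j assume less: "N * i + j < m + m'"
  have "f $ b $ a * g $ (j - b) $ (i - a) = 0" if "b \<le> j" "a \<le> i" for a b
  proof -
    \<comment> \<open>The weight splits over the two factors; with this equation the products by
      \<open>N\<close> are mere atoms of a linear problem.\<close>
    have "N * i = N * a + N * (i - a)"
      using that by (simp flip: distrib_left)
    then have "N * a + b < m \<or> N * (i - a) + (j - b) < m'"
      using less that by linarith
    then show ?thesis
      using f g by (auto dest: weight_idealD)
  qed
  then show "(f * g) $ j $ i = 0"
    unfolding fps2_mult_nth by (intro sum.neutral ballI) (simp del: mult_eq_0_iff)
qed

lemma weight_ideal_0: "weight_ideal N 0 = UNIV"
  by (simp add: weight_ideal_def)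

lemma subspace_weight_ideal: "ideal.subspace (weight_ideal N m)"
proof (rule ideal.subspaceI)
  show "0 \<in> weight_ideal N m"
    by (simp add: weight_ideal_def)
  show "f + g \<in> weight_ideal N m" if "f \<in> weight_ideal N m" "g \<in> weight_ideal N m" for f g
    using that by (simp add: weight_ideal_def)
  show "c * f \<in> weight_ideal N m" if "f \<in> weight_ideal N m" for c f
    \<comment> \<open>Every scalar has weight at least 0, so scaling is a case of the product
      rule.\<close>
    using weight_ideal_mult[of c N 0 f m] that by (simp add: weight_ideal_0)
qed

lemma weight_ideal_power: "f \<in> weight_ideal N m \<Longrightarrow> f ^ n \<in> weight_ideal N (n * m)"
  by (induction n) (auto simp: weight_ideal_0 intro: weight_ideal_mult)

lemma ideal_power_weight_ideal:
  "ideal_power (weight_ideal N m :: 'k::field fps2 set) n \<subseteq> weight_ideal N (n * m)"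
proof (induction n)
  case (Suc n)
  show ?case
    unfolding ideal_power.simps ideal_prod_def mult_Suc
  proof (rule ideal.span_minimal[OF subsetI subspace_weight_ideal])
    fix f :: "'k fps2"
    assume "f \<in> {a * b |a b. a \<in> weight_ideal N m \<and> b \<in> ideal_power (weight_ideal N m) n}"
    then obtain a b where "f = a * b" "a \<in> weight_ideal N m" "b \<in> ideal_power (weight_ideal N m) n"
      by blast
    then show "f \<in> weight_ideal N (m + n * m)"
      using weight_ideal_mult[OF _ subsetD[OF Suc]] by metis
  qed
qed (simp add: weight_ideal_0)

lemma x_var_in_weight_ideal: "x_var \<in> weight_ideal N N"
  by (auto simp: weight_ideal_def x_var_def)

lemma y_var_in_weight_ideal: "y_var \<in> weight_ideal N 1"
  by (simp add: weight_ideal_def y_var_def)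

text \<open>The only monomial of \<open>y_var ^ q\<close> has weight q. This settles the
  non-containment in the theorem and places the generator y^(N^2) in \<open>span_J\<close>.\<close>

lemma y_var_power_in_weight_ideal_iff:
  "y_var ^ q \<in> (weight_ideal N m :: 'k::field fps2 set) \<longleftrightarrow> m \<le> q"
proof
  assume "y_var ^ q \<in> (weight_ideal N m :: 'k fps2 set)"
  moreover have "(y_var ^ q) $ q $ 0 \<noteq> (0 :: 'k)"
    by (simp add: y_var_def)
  ultimately show "m \<le> q"
    using weight_idealD[of "y_var ^ q" N m 0 q] by force
next
  assume "m \<le> q"
  then show "y_var ^ q \<in> (weight_ideal N m :: 'k fps2 set)"
    using weight_ideal_power[OF y_var_in_weight_ideal, of q N] weight_ideal_mono[of m q N] by auto
qed

section \<open>Initial monomials\<close>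

text \<open>
  Breaking ties of the weight by the exponent of \<open>x\<close> makes the initial monomial unique,
  hence multiplicative.
\<close>

definition initial_monomial :: "nat \<Rightarrow> 'k::field fps2 \<Rightarrow> nat \<Rightarrow> nat \<Rightarrow> bool" where
  "initial_monomial N f i j \<longleftrightarrow> f $ j $ i \<noteq> 0 \<and>
     (\<forall>a b. f $ b $ a \<noteq> 0 \<longrightarrow> N * i + j < N * a + b \<or> N * i + j = N * a + b \<and> i \<le> a)"

text \<open>A pair of monomials that contributes to x^r y^s consists of monomials not before the
  initial ones. The order is compatible with products, so x^r y^s is not before the product of the
  initial monomials, and equality forces the pair to be the initial one.\<close>

lemma initial_monomial_mult_nth:
  assumes f: "initial_monomial N f i j" and g: "initial_monomial N g i' j'"
    and le: "a \<le> r" "b \<le> s" and nz: "f $ b $ a * g $ (s - b) $ (r - a) \<noteq> 0"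
  shows "N * (i + i') + (j + j') < N * r + s \<or>
    N * (i + i') + (j + j') = N * r + s \<and> i + i' \<le> r \<and> (r = i + i' \<longrightarrow> a = i \<and> b = j)"
proof -
  have r: "N * r = N * a + N * (r - a)"
    using le by (simp flip: distrib_left)
  have fa: "N * i + j < N * a + b \<or> N * i + j = N * a + b \<and> i \<le> a"
    using f nz by (auto simp: initial_monomial_def)
  have ga: "N * i' + j' < N * (r - a) + (s - b) \<or>
      N * i' + j' = N * (r - a) + (s - b) \<and> i' \<le> r - a"
    using g nz by (auto simp: initial_monomial_def)
  show ?thesis
  \<comment> \<open>If both weights agree with the initial ones, the exponents of x decide;
    otherwise the weight of the product is strictly larger.\<close>
  proof (cases "N * i + j = N * a + b \<and> N * i' + j' = N * (r - a) + (s - b)")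
    case True
    then have "i \<le> a" "i' \<le> r - a"
      using fa ga by auto
    then have "i + i' \<le> r" "r = i + i' \<longrightarrow> a = i"
      using le by auto
    then show ?thesis
      using True r le by (auto simp: distrib_left)
  next
    case False
    then have "N * (i + i') + (j + j') < N * r + s"
      using fa ga r le unfolding distrib_left by linarith
    then show ?thesis ..
  qed
qed

lemma initial_monomial_mult:
  assumes f: "initial_monomial N f i j" and g: "initial_monomial N g i' j'"
  shows "initial_monomial N (f * g) (i + i') (j + j')"
  unfolding initial_monomial_def
proof safe
  \<comment> \<open>Only the pair of initial monomials contributes to this coefficient, and a
    product of two nonzero elements of the field is nonzero.\<close>
  have "(f * g) $ (j + j') $ (i + i') =
      (\<Sum>b=0..j+j'. \<Sum>a=0..i+i'. if b = j then if a = i then f $ j $ i * g $ j' $ i' else 0 else 0)"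
    unfolding fps2_mult_nth
  proof (intro sum.cong refl)
    fix b a assume "b \<in> {0..j + j'}" "a \<in> {0..i + i'}"
    then show "f $ b $ a * g $ (j + j' - b) $ (i + i' - a) =
        (if b = j then if a = i then f $ j $ i * g $ j' $ i' else 0 else 0)"
      using initial_monomial_mult_nth[OF f g, of a "i + i'" b "j + j'"] by force
  qed
  also have "\<dots> = (\<Sum>b=0..j+j'. if b = j then f $ j $ i * g $ j' $ i' else 0)"
    by (intro sum.cong) auto
  also have "\<dots> = f $ j $ i * g $ j' $ i'"
    by simp
  finally show "(f * g) $ (j + j') $ (i + i') = 0 \<Longrightarrow> False"
    using f g by (simp add: initial_monomial_def)
next
  fix r s assume nz: "(f * g) $ s $ r \<noteq> 0"
    and not_less: "\<not> N * (i + i') + (j + j') < N * r + s"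
  obtain a b where "a \<le> r" "b \<le> s" "f $ b $ a * g $ (s - b) $ (r - a) \<noteq> 0"
    using nz unfolding fps2_mult_nth by (metis (no_types, lifting) atLeastAtMost_iff sum.neutral)
  from initial_monomial_mult_nth[OF f g this] not_less
  show "N * (i + i') + (j + j') = N * r + s" "i + i' \<le> r"
    by auto
qed

lemma initial_monomial_power:
  "initial_monomial N f i j \<Longrightarrow> initial_monomial N (f ^ n) (n * i) (n * j)"
proof (induction n)
  case 0
  show ?case
    by (auto simp: initial_monomial_def fps_one_nth split: if_splits)
next
  case (Suc n)
  then show ?case
    using initial_monomial_mult[of N f i j "f ^ n" "n * i" "n * j"] by simp
qed

lemma obtain_initial_monomial:
  assumes "f \<noteq> 0"
  obtains i j where "initial_monomial N f i j"
proof -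
  \<comment> \<open>\<open>P c i\<close> says that some monomial of weight c with x-exponent i
    occurs in f. The weight is minimized first, then the x-exponent; together they determine
    j.\<close>
  define P where "P = (\<lambda>c i. \<exists>j. c = N * i + j \<and> f $ j $ i \<noteq> 0)"
  define c where "c = (LEAST c. \<exists>i. P c i)"
  define i where "i = (LEAST i. P c i)"
  have "\<exists>c i. P c i"
    using assms unfolding P_def by (metis fps_ext fps_zero_nth)
  then have "\<exists>i. P c i"
    unfolding c_def by (rule LeastI_ex)
  then have "P c i"
    unfolding i_def by (rule LeastI_ex)
  then obtain j where j: "c = N * i + j" "f $ j $ i \<noteq> 0"
    by (auto simp: P_def)
  have "N * i + j < N * a + b \<or> N * i + j = N * a + b \<and> i \<le> a" if "f $ b $ a \<noteq> 0" for a b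
  proof -
    have P: "P (N * a + b) a"
      using that by (auto simp: P_def)
    then have "c \<le> N * a + b"
      unfolding c_def by (blast intro: Least_le)
    moreover have "i \<le> a" if "c = N * a + b"
      using P that unfolding i_def by (blast intro: Least_le)
    ultimately show ?thesis
      using j by linarith
  qed
  with j show ?thesis
    by (intro that[of i j]) (simp add: initial_monomial_def)
qed

section \<open>Weight ideals are integrally closed\<close>

text \<open>If r had weight c < m, every other term of its integral equation would have weight above
  n c, whereas r^n has weight exactly n c because initial monomials are multiplicative.\<close>

lemma integral_closure_weight_ideal:
  "integral_closure (weight_ideal N m) \<subseteq> (weight_ideal N m :: 'k::field fps2 set)"
proof
  fix r :: "'k fps2" assume "r \<in> integral_closure (weight_ideal N m)"
  then obtain n a where n: "n \<ge> 1"
    and a: "\<And>i. i \<in> {1..n} \<Longrightarrow> a i \<in> ideal_power (weight_ideal N m) i"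
    and eq: "r ^ n + (\<Sum>i=1..n. a i * r ^ (n - i)) = 0"
    unfolding integral_closure_def by blast
  show "r \<in> weight_ideal N m"
  proof (cases "r = 0")
    case True
    then show ?thesis
      using subspace_weight_ideal ideal.subspace_0 by blast
  next
    case False
    then obtain i j where ij: "initial_monomial N r i j"
      using obtain_initial_monomial by blast
    define c where "c = N * i + j"
    have r: "r \<in> weight_ideal N c"
      using ij by (force simp: weight_ideal_def initial_monomial_def c_def)
    show ?thesis
    proof (cases "m \<le> c")
      case True
      then show ?thesis
        using r weight_ideal_mono by blast
    next
      case False
      \<comment> \<open>The gain of 1 over \<open>n * c\<close> comes from
        \<open>l * c < l * m\<close>, which holds as l is at least 1.\<close>
      have "a l * r ^ (n - l) \<in> weight_ideal N (n * c + 1)" if l: "l \<in> {1..n}" for l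
      proof -
        have "a l \<in> weight_ideal N (l * m)"
          using a[OF l] ideal_power_weight_ideal by blast
        then have *: "a l * r ^ (n - l) \<in> weight_ideal N (l * m + (n - l) * c)"
          by (rule weight_ideal_mult[OF _ weight_ideal_power[OF r]])
        have "n * c = l * c + (n - l) * c"
          using l by (simp flip: distrib_right)
        moreover have "l * c < l * m"
          using l False by simp
        ultimately have "n * c + 1 \<le> l * m + (n - l) * c"
          by linarith
        then show ?thesis
          using * weight_ideal_mono by blast
      qed
      then have "(\<Sum>i=1..n. a i * r ^ (n - i)) \<in> weight_ideal N (n * c + 1)"
        by (intro ideal.subspace_sum subspace_weight_ideal) auto
      then have "- (\<Sum>i=1..n. a i * r ^ (n - i)) \<in> weight_ideal N (n * c + 1)"
        using ideal.subspace_neg subspace_weight_ideal by blast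
      then have "r ^ n \<in> weight_ideal N (n * c + 1)"
        using eq by (metis eq_neg_iff_add_eq_0)
      then have "(r ^ n) $ (n * j) $ (n * i) = 0"
        by (rule weight_idealD) (simp add: c_def algebra_simps)
      then show ?thesis
        using initial_monomial_power[OF ij, of n] by (simp add: initial_monomial_def)
    qed
  qed
qed

section \<open>Monomial generators of the weight ideals\<close>

text \<open>The ideal \<open>P\<close> is arbitrary so that the lemma serves both for the span of
  \<open>J N\<close> and for the valuation ideals {v >= t}. Induction on m peels off one factor x at
  a time, which avoids infinite sums of monomials.\<close>

lemma weight_ideal_minimal:
  assumes "ideal.subspace P" "\<And>i. i \<le> m \<Longrightarrow> x_var ^ i * y_var ^ (N * (m - i)) \<in> P"
  shows "weight_ideal N (N * m) \<subseteq> (P :: 'k::field fps2 set)"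
  using assms
proof (induction m arbitrary: P)
  case 0
  have "f \<in> P" for f
    using ideal.subspace_scale[OF 0(1) 0(2)[of 0], of f] by simp
  then show ?case by blast
next
  case (Suc m)
  \<comment> \<open>The colon ideal (P : x). It contains the generators for m because x times such a
    generator is a generator for m + 1.\<close>
  define Q where "Q = {g. x_var * g \<in> P}"
  have "ideal.subspace Q"
  proof (rule ideal.subspaceI)
    show "c * g \<in> Q" if "g \<in> Q" for c g
      using ideal.subspace_scale[OF Suc.prems(1), of "x_var * g" c] that
      unfolding Q_def mem_Collect_eq by (metis mult.left_commute)
    show "f + g \<in> Q" if "f \<in> Q" "g \<in> Q" for f g
      using ideal.subspace_add[OF Suc.prems(1), of "x_var * f" "x_var * g"] that
      by (simp add: Q_def distrib_left)
  qed (use ideal.subspace_0[OF Suc.prems(1)] in \<open>simp add: Q_def\<close>)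
  moreover have "x_var ^ i * y_var ^ (N * (m - i)) \<in> Q" if "i \<le> m" for i
    using Suc.prems(2)[of "Suc i"] that
    unfolding Q_def mem_Collect_eq power_Suc mult.assoc diff_Suc_Suc by simp
  ultimately have Q: "weight_ideal N (N * m) \<subseteq> Q"
    by (rule Suc.IH)
  show ?case
  proof
    fix f :: "'k fps2" assume f: "f \<in> weight_ideal N (N * Suc m)"
    \<comment> \<open>Split f into the terms divisible by x and the terms free of x. Dividing the
      former by x lowers the weight by N; the latter start at y^(N(m+1)), so they are a multiple of
      the generator with i = 0.\<close>
    define g where "g = Abs_fps (\<lambda>j. fps_shift 1 (f $ j))"
    define h where "h = Abs_fps (\<lambda>j. fps_const (f $ (j + N * Suc m) $ 0))"
    have "g \<in> weight_ideal N (N * m)"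
      using f by (auto simp: weight_ideal_def g_def)
    then have "x_var * g \<in> P"
      using Q by (auto simp: Q_def)
    moreover have "h * y_var ^ (N * Suc m) \<in> P"
      using Suc.prems(2)[of 0] by (intro ideal.subspace_scale[OF Suc.prems(1)]) simp
    moreover have "f = x_var * g + h * y_var ^ (N * Suc m)"
    proof (intro fps_ext)
      fix j i
      show "f $ j $ i = (x_var * g + h * y_var ^ (N * Suc m)) $ j $ i"
        using weight_idealD[OF f, of 0 j]
        by (cases i) (auto simp: x_var_def y_var_def g_def h_def fps_X_power_mult_right_nth
            simp del: mult_Suc_right)
    qed
    ultimately show "f \<in> P"
      using ideal.subspace_add[OF Suc.prems(1)] by simp
  qed
qed

section \<open>Powers of ideals, integral closure and the ideal J_N\<close>

text \<open>\<open>J N\<close> is by definition a set of integral elements. Its first power is the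
  product with the whole ring, so for p = 1 the theorem concerns
  \<open>ideal.span (J N)\<close>.\<close>

lemma ideal_power_Suc_0: "ideal_power I (Suc 0) = ideal.span I"
proof (rule antisym)
  show "ideal_power I (Suc 0) \<subseteq> ideal.span I"
    unfolding ideal_power.simps ideal_prod_def
  proof (intro ideal.span_minimal ideal.subspace_span subsetI)
    fix c assume "c \<in> {a * b |a b. a \<in> I \<and> b \<in> (UNIV :: 'a set)}"
    then obtain a b where "c = b * a" "a \<in> I"
      by (auto simp: mult.commute)
    then show "c \<in> ideal.span I"
      by (simp add: ideal.span_scale ideal.span_base)
  qed
  have "a = a * 1" for a :: 'a
    by simp
  then show "ideal.span I \<subseteq> ideal_power I (Suc 0)"
    unfolding ideal_power.simps ideal_prod_def by (intro ideal.span_mono) blast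
qed

lemma ideal_prod_memI: "a \<in> I \<Longrightarrow> b \<in> I' \<Longrightarrow> a * b \<in> ideal_prod I I'"
  unfolding ideal_prod_def by (intro ideal.span_base) blast

lemma power_in_ideal_power: "a \<in> I \<Longrightarrow> a ^ n \<in> ideal_power I n"
  by (induction n) (auto intro: ideal_prod_memI)

lemma ideal_prod_mono: "I \<subseteq> I' \<Longrightarrow> K \<subseteq> K' \<Longrightarrow> ideal_prod I K \<subseteq> ideal_prod I' K'"
  unfolding ideal_prod_def by (intro ideal.span_mono) blast

lemma ideal_power_mono: "I \<subseteq> I' \<Longrightarrow> ideal_power I n \<subseteq> ideal_power I' n"
  by (induction n) (simp_all add: ideal_prod_mono)

lemma integral_closure_mono: "I \<subseteq> I' \<Longrightarrow> integral_closure I \<subseteq> integral_closure I'"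
  unfolding integral_closure_def by (blast dest: subsetD[OF ideal_power_mono])

lemma subspace_ideal_power: "ideal.subspace (ideal_power I n)"
  by (cases n) (simp_all add: ideal_prod_def)

text \<open>The integral equation is T^n - r^n = 0, with all intermediate coefficients 0.\<close>

lemma integral_closure_rootI:
  assumes "n \<ge> 1" "r ^ n \<in> ideal_power I n"
  shows "r \<in> integral_closure I"
proof -
  define a where "a i = (if i = n then - (r ^ n) else 0)" for i
  have "(\<Sum>i=1..n. a i * r ^ (n - i)) = (\<Sum>i=1..n. if n = i then - (r ^ n) else 0)"
    by (intro sum.cong refl) (simp add: a_def)
  also have "\<dots> = - (r ^ n)"
    unfolding sum.delta'[OF finite_atLeastAtMost] using assms(1) by simp
  finally have "r ^ n + (\<Sum>i=1..n. a i * r ^ (n - i)) = 0"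
    by simp
  moreover have "a i \<in> ideal_power I i" for i
    unfolding a_def
    using ideal.subspace_0[OF subspace_ideal_power, of I i]
      ideal.subspace_neg[OF subspace_ideal_power assms(2)] by (cases "i = n") auto
  ultimately show ?thesis
    unfolding integral_closure_def using assms(1) by blast
qed

lemma power_mult_power_in_ideal_power:
  assumes "a \<in> I" "b \<in> I"
  shows "a ^ i * b ^ j \<in> ideal_power I (i + j)"
proof (induction i)
  case 0
  show ?case
    using power_in_ideal_power[OF assms(2)] by simp
next
  case (Suc i)
  show ?case
    using ideal_prod_memI[OF assms(1) Suc] by (simp add: mult.assoc)
qed

lemma subset_integral_closure: "I \<subseteq> integral_closure I"
  by (rule subsetI, rule integral_closure_rootI[OF order_refl power_in_ideal_power])

lemma span_J: "ideal.span (J N) = (weight_ideal N (N ^ 2) :: 'k::field fps2 set)"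
\<comment> \<open>For N = 0 both sides are the whole ring; N-th roots, used below, require N >
  0.\<close>
proof (cases "N = 0")
  case True
  have "1 \<in> (J N :: 'k fps2 set)"
    unfolding J_def using True by (intro subsetD[OF subset_integral_closure] ideal.span_base) simp
  then have "c * 1 \<in> ideal.span (J N)" for c :: "'k fps2"
    by (intro ideal.span_scale ideal.span_base)
  then show ?thesis
    using True by (auto simp: weight_ideal_0)
next
  case False
  define I :: "'k fps2 set" where "I = ideal.span {x_var ^ N, y_var ^ (N ^ 2)}"
  have "I \<subseteq> weight_ideal N (N ^ 2)"
    unfolding I_def
    using weight_ideal_power[OF x_var_in_weight_ideal, of N N]
    by (intro ideal.span_minimal subspace_weight_ideal)
       (simp add: power2_eq_square y_var_power_in_weight_ideal_iff)
  then have "(J N :: 'k fps2 set) \<subseteq> weight_ideal N (N ^ 2)"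
    unfolding J_def I_def[symmetric]
    by (rule order_trans[OF integral_closure_mono integral_closure_weight_ideal])
  then have "ideal.span (J N :: 'k fps2 set) \<subseteq> weight_ideal N (N ^ 2)"
    by (intro ideal.span_minimal subspace_weight_ideal)
  moreover have "weight_ideal N (N * N) \<subseteq> ideal.span (J N :: 'k fps2 set)"
  proof (rule weight_ideal_minimal)
    fix i assume i: "i \<le> N"
    \<comment> \<open>The N-th power of the monomial is a product of i copies of x^N and N - i
      copies of y^(N^2), hence lies in I^N.\<close>
    have "(x_var ^ i * y_var ^ (N * (N - i)) :: 'k fps2) ^ N =
        (x_var ^ N) ^ i * (y_var ^ (N ^ 2)) ^ (N - i)"
      by (simp add: power_mult_distrib power2_eq_square mult_ac flip: power_mult)
    moreover have "(x_var ^ N) ^ i * (y_var ^ (N ^ 2)) ^ (N - i) \<in> ideal_power I (i + (N - i))"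
      unfolding I_def by (intro power_mult_power_in_ideal_power ideal.span_base) auto
    ultimately have "(x_var ^ i * y_var ^ (N * (N - i)) :: 'k fps2) ^ N \<in> ideal_power I N"
      using i by simp
    then have "x_var ^ i * y_var ^ (N * (N - i)) \<in> (J N :: 'k fps2 set)"
      unfolding J_def I_def[symmetric]
      using False by (intro integral_closure_rootI[of N]) (auto simp: Suc_le_eq)
    then show "x_var ^ i * y_var ^ (N * (N - i)) \<in> ideal.span (J N :: 'k fps2 set)"
      by (rule ideal.span_base)
  qed simp
  ultimately show ?thesis
    by (simp add: power2_eq_square)
qed

section \<open>Values of a valuation on the two families of ideals\<close>

context
  fixes \<mm> :: "'a::idom set" and v :: "'a \<Rightarrow> ereal"
  assumes v: "centered_valuation \<mm> v"
begin

lemma valuation_nonneg: "0 \<le> v f"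
  using v unfolding centered_valuation_def by (cases "f = 0") auto

lemma valuation_mult: "v (f * g) = v f + v g"
  using v by (simp add: centered_valuation_def)

lemma valuation_add: "min (v f) (v g) \<le> v (f + g)"
  using v unfolding centered_valuation_def by blast

lemma valuation_finite: "f \<noteq> 0 \<Longrightarrow> \<exists>r. v f = ereal r"
  using v unfolding centered_valuation_def by (cases "v f") force+

text \<open>From v(1) = v(1) + v(1); finiteness excludes the solution \<infinity>.\<close>

lemma valuation_1: "v 1 = 0"
  using valuation_mult[of 1 1] valuation_finite[of 1] by auto

lemma valuation_power:
  assumes "v f = ereal r"
  shows "v (f ^ n) = ereal (real n * r)"
  using assms by (induction n) (simp_all add: valuation_1 valuation_mult algebra_simps)

text \<open>This reduces a lower bound for v on an ideal to its generators.\<close>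

lemma subspace_valuation_ge: "ideal.subspace {f. t \<le> v f}"
proof (rule ideal.subspaceI)
  show "0 \<in> {f. t \<le> v f}"
    using v by (simp add: centered_valuation_def)
  show "f + g \<in> {f. t \<le> v f}" if "f \<in> {f. t \<le> v f}" "g \<in> {f. t \<le> v f}" for f g
    using that order_trans[OF _ valuation_add[of f g], of t] by simp
  show "c * f \<in> {f. t \<le> v f}" if "f \<in> {f. t \<le> v f}" for c f
    using that add_mono[OF valuation_nonneg[of c], of t "v f"] by (simp add: valuation_mult)
qed

lemma valuation_ideal_power_ge:
  assumes "\<And>f. f \<in> I \<Longrightarrow> ereal t \<le> v f"
  shows "f \<in> ideal_power I n \<Longrightarrow> ereal (real n * t) \<le> v f"
proof (induction n arbitrary: f)
  case 0
  then show ?case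
    using valuation_nonneg by (simp flip: zero_ereal_def)
next
  case (Suc n)
  have "ideal_power I (Suc n) \<subseteq> {f. ereal (real (Suc n) * t) \<le> v f}"
    unfolding ideal_power.simps ideal_prod_def
  proof (rule ideal.span_minimal[OF subsetI subspace_valuation_ge])
    fix h assume "h \<in> {a * b |a b. a \<in> I \<and> b \<in> ideal_power I n}"
    then obtain a b where h: "h = a * b" "a \<in> I" "b \<in> ideal_power I n"
      by blast
    then have "ereal t + ereal (real n * t) \<le> v a + v b"
      by (intro add_mono assms Suc.IH)
    then show "h \<in> {f. ereal (real (Suc n) * t) \<le> v f}"
      using h by (simp add: valuation_mult algebra_simps)
  qed
  then show ?case
    using Suc.prems by blast
qed

end

lemma val_ideal_eqI: "f \<in> I \<Longrightarrow> v f = t \<Longrightarrow> (\<And>g. g \<in> I \<Longrightarrow> t \<le> v g) \<Longrightarrow> val_ideal v I = t"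
  unfolding val_ideal_def by (rule Least_equality) auto

lemma x_var_neq_0: "x_var \<noteq> 0" and y_var_neq_0: "y_var \<noteq> 0"
  by (simp_all add: x_var_def y_var_def)

lemma vars_in_max_ideal: "x_var \<in> max_ideal" "y_var \<in> max_ideal"
  by (simp_all add: max_ideal_def ideal.span_base)

context
  fixes v :: "'k::field fps2 \<Rightarrow> ereal" and a b :: real
  assumes v: "centered_valuation max_ideal v"
    and a: "v x_var = ereal a" and b: "v y_var = ereal b"
begin

text \<open>The minimum is attained at the q-th power of whichever variable has the smaller
  value.\<close>

lemma val_max_ideal_power: "val_ideal v (ideal_power max_ideal q) = ereal (real q * min a b)"
proof -
  obtain s where s: "s \<in> max_ideal" "v s = ereal (min a b)"
    using vars_in_max_ideal a b by (metis min_def)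
  have "max_ideal \<subseteq> {f. ereal (min a b) \<le> v f}"
    unfolding max_ideal_def using a b
    by (intro ideal.span_minimal subspace_valuation_ge[OF v]) auto
  then show ?thesis
    using valuation_ideal_power_ge[OF v, of max_ideal "min a b" _ q] valuation_power[OF v s(2)] s(1)
    by (intro val_ideal_eqI[of "s ^ q"] power_in_ideal_power) auto
qed

text \<open>The generator x^i y^(N(N-i)) has value i a + (N-i) N b, which is at least N a since N b
  is at least a; x^N attains this bound.\<close>

lemma val_span_J:
  assumes "a \<le> real N * b"
  shows "val_ideal v (ideal.span (J N)) = ereal (real N * a)"
proof (rule val_ideal_eqI[of "x_var ^ N"])
  show "x_var ^ N \<in> ideal.span (J N)"
    unfolding J_def by (intro ideal.span_base subsetD[OF subset_integral_closure]) simp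
  show "v (x_var ^ N) = ereal (real N * a)"
    by (rule valuation_power[OF v a])
  have "weight_ideal N (N * N) \<subseteq> {f. ereal (real N * a) \<le> v f}"
  proof (intro weight_ideal_minimal subspace_valuation_ge[OF v])
    fix i assume i: "i \<le> N"
    have "real N * a = real i * a + real (N - i) * a"
      using i by (simp add: of_nat_diff algebra_simps)
    also have "\<dots> \<le> real i * a + real (N - i) * (real N * b)"
      using assms by (intro add_left_mono mult_left_mono) auto
    finally show "x_var ^ i * y_var ^ (N * (N - i)) \<in> {f. ereal (real N * a) \<le> v f}"
      by (simp add: valuation_mult[OF v] valuation_power[OF v a] valuation_power[OF v b] mult_ac)
  qed
  then show "ereal (real N * a) \<le> v g" if "g \<in> ideal.span (J N)" for g
    using that by (auto simp: span_J power2_eq_square)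
qed

end

section \<open>A common slope bound and the conclusion\<close>

text \<open>Here finiteness of the set enters: each valuation has a finite slope v(x)/v(y), as v(y)
  is positive, and finitely many slopes have a common bound.\<close>

lemma finite_valuations_bound:
  assumes "finite V" and V: "\<And>v. v \<in> V \<Longrightarrow> centered_valuation (max_ideal :: 'k::field fps2 set) v"
  obtains C :: nat where "C \<ge> 1"
    "\<And>v a b. v \<in> V \<Longrightarrow> v x_var = ereal a \<Longrightarrow> v y_var = ereal b \<Longrightarrow> a \<le> real C * b \<and> a > 0 \<and> b > 0"
proof -
  have pos: "a > 0 \<and> b > 0" if "v \<in> V" "v x_var = ereal a" "v y_var = ereal b" for v a b
  proof -
    have "v x_var > 0" "v y_var > 0"
      using V[OF that(1)] vars_in_max_ideal unfolding centered_valuation_def by blast+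
    then show ?thesis
      using that by simp
  qed
  have "\<forall>v\<in>V. \<exists>c::nat. \<forall>a b. v x_var = ereal a \<longrightarrow> v y_var = ereal b \<longrightarrow> a \<le> real c * b"
  proof
    fix v assume "v \<in> V"
    obtain a b where ab: "v x_var = ereal a" "v y_var = ereal b"
      using valuation_finite[OF V[OF \<open>v \<in> V\<close>]] x_var_neq_0 y_var_neq_0 by meson
    obtain c :: nat where "a / b \<le> real c"
      using real_arch_simple by blast
    then have "a \<le> real c * b"
      using pos[OF \<open>v \<in> V\<close> ab] by (simp add: divide_le_eq)
    then show "\<exists>c::nat. \<forall>a b. v x_var = ereal a \<longrightarrow> v y_var = ereal b \<longrightarrow> a \<le> real c * b"
      using ab by auto
  qed
  then obtain c :: "_ \<Rightarrow> nat" where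
    c: "\<And>v a b. v \<in> V \<Longrightarrow> v x_var = ereal a \<Longrightarrow> v y_var = ereal b \<Longrightarrow> a \<le> real (c v) * b"
    by metis
  show ?thesis
  \<comment> \<open>The sum dominates each of its terms, and the successor ensures that the bound is
    at least 1.\<close>
  proof (rule that[of "Suc (\<Sum>v\<in>V. c v)"])
    fix v a b assume *: "v \<in> V" "v x_var = ereal a" "v y_var = ereal b"
    have "c v \<le> Suc (\<Sum>v\<in>V. c v)"
      using member_le_sum[of v V c] * assms(1) by simp
    then have "real (c v) * b \<le> real (Suc (\<Sum>v\<in>V. c v)) * b"
      using pos[OF *] by (intro mult_right_mono) (simp_all del: of_nat_Suc)
    then show "a \<le> real (Suc (\<Sum>v\<in>V. c v)) * b \<and> a > 0 \<and> b > 0"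
      using c[OF *] pos[OF *] by linarith
  qed simp
qed

theorem theorem12p4:
  shows "(\<forall>V :: ('k::field fps2 \<Rightarrow> ereal) set.
            finite V \<and> (\<forall>v\<in>V. centered_valuation max_ideal v) \<longrightarrow>
            (\<exists>N\<ge>2. \<exists>p\<ge>1. \<exists>q\<ge>1.
               (\<forall>v\<in>V. val_ideal v (ideal_power max_ideal q) \<ge> val_ideal v (ideal_power (J N) p)) \<and>
               \<not> ideal_power max_ideal q \<subseteq> ideal_power (J N :: 'k fps2 set) p \<and>
               ideal_power (J N :: 'k fps2 set) p = integral_closure (ideal_power (J N) p))) \<and>
         \<not> (\<exists>V :: ('k fps2 \<Rightarrow> ereal) set.
              finite V \<and> (\<forall>v\<in>V. centered_valuation max_ideal v) \<and> universal_testing_set V)"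
    (is "(\<forall>V. ?valuations V \<longrightarrow> (\<exists>N\<ge>2. \<exists>p\<ge>1. \<exists>q\<ge>1. ?escapes V N p q)) \<and> _")
proof -
  have escapes: "\<exists>N\<ge>2. \<exists>p\<ge>1. \<exists>q\<ge>1. ?escapes V N p q" if V: "?valuations V" for V
  proof -
    obtain C where C: "C \<ge> 1"
      and bound: "\<And>v a b. v \<in> V \<Longrightarrow> v x_var = ereal a \<Longrightarrow> v y_var = ereal b \<Longrightarrow>
        a \<le> real C * b \<and> a > 0 \<and> b > 0"
      using V by (auto intro: finite_valuations_bound[of V])
    \<comment> \<open>\<open>N\<close> at least \<open>C\<close> makes \<open>val_span_J\<close>
      applicable; strictly larger makes q = N C smaller than N^2.\<close>
    define N where "N = Suc C"
    have J: "ideal_power (J N) 1 = (weight_ideal N (N ^ 2) :: 'k fps2 set)"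
      by (simp add: ideal_power_Suc_0 span_J del: ideal_power.simps)
    have "val_ideal v (ideal_power (J N) 1) \<le> val_ideal v (ideal_power max_ideal (N * C))"
      if "v \<in> V" for v
    proof -
      have v: "centered_valuation max_ideal v"
        using V that by blast
      obtain a b where ab: "v x_var = ereal a" "v y_var = ereal b"
        using valuation_finite[OF v] x_var_neq_0 y_var_neq_0 by meson
      note * = bound[OF that ab]
      have "real C * b \<le> real N * b"
        using * by (intro mult_right_mono) (auto simp: N_def)
      then have 1: "val_ideal v (ideal_power (J N) 1) = ereal (real N * a)"
        using val_span_J[OF v ab, of N] * unfolding One_nat_def ideal_power_Suc_0 by linarith
      \<comment> \<open>If the minimum is b this is the slope bound; if it is a, it follows from
        \<open>C\<close> being at least 1.\<close>
      have "a \<le> real C * min a b"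
        using * C mult_right_mono[of 1 "real C" a] by (auto simp: min_def)
      then show ?thesis
        unfolding 1 val_max_ideal_power[OF v ab] by (simp add: mult.assoc mult_left_mono)
    qed
    moreover have "\<not> ideal_power max_ideal (N * C) \<subseteq> ideal_power (J N :: 'k fps2 set) 1"
    proof
      assume "ideal_power max_ideal (N * C) \<subseteq> ideal_power (J N :: 'k fps2 set) 1"
      then have "y_var ^ (N * C) \<in> (weight_ideal N (N ^ 2) :: 'k fps2 set)"
        using power_in_ideal_power[OF vars_in_max_ideal(2)] unfolding J by blast
      then show False
        unfolding y_var_power_in_weight_ideal_iff by (simp add: N_def power2_eq_square)
    qed
    moreover have "ideal_power (J N :: 'k fps2 set) 1 = integral_closure (ideal_power (J N) 1)"
      unfolding J by (intro antisym subset_integral_closure integral_closure_weight_ideal)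
    ultimately show ?thesis
      using C by (intro exI[of _ N] exI[of _ 1] exI[of _ "N * C"] conjI ballI) (simp_all add: N_def)
  qed
  \<comment> \<open>The power of \<open>J N\<close> equals its integral closure, so the failed
    containment also refutes \<open>universal_testing_set\<close>.\<close>
  then show ?thesis
    unfolding universal_testing_set_def by metis
qed

end
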